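(* Let $\{T,\Lambda,M\}$ be a measurable space with a measure $\mu$, let $X=\{X(t),t\in T\}$ be a measurable random process from the space $Sub_\varphi(\Omega)$, and let $X_N=\{X_N(t),t\in T\}$ be a random process from $Sub_\varphi(\Omega)$ (a model of $X$). Let $f$ be a function such that $\varphi(u)=\int_0^uf(v)\,dv$ for all $u>0$. Let $p\ge1$ and $$c_N=\int_T\big(\tau_\varphi(X(t)-X_N(t))\big)^p\,d\mu(t)<\infty.$$ The model $X_N$ approximates the random process $X$ with reliability $1-\alpha$ and accuracy $\delta$ in the space $L_p(T)$, that is, $$P\left\{\left(\int_T|X(t)-X_N(t)|^p\,d\mu(t)\right)^{1/p}>\delta\right\}\le\alpha,$$ when $$c_N\le\frac{\delta}{\big(\varphi^{*(-1)}(\ln\frac2\alpha)\big)^p}\qquad\text{and}\qquad\delta>c_N\left(f\left(\frac{c_N^{1/p}p}{\delta^{1/p}}\right)\right)^p,$$ where $\varphi^*$ is the Young–Fenchel transform of the function $\varphi$ and $\varphi^{*(-1)}$ is the inverse function of $\varphi^*$.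
   Context: $\varphi$ is an $N$-function satisfying condition Q. An $N$-function is a continuous even convex function on $\mathbb R$, monotonically increasing for $x>0$, with $\varphi(0)=0$, $\varphi(x)/x\to0$ as $x\to0$ and $\varphi(x)/x\to\infty$ as $x\to\infty$. Condition Q: $\liminf_{x\to0}\varphi(x)/x^2=C>0$ (possibly $C=+\infty$). The Young–Fenchel transform is $\varphi^*(x)=\sup_{y\in\mathbb R}(xy-\varphi(y))$. A random variable $\xi$ belongs to $Sub_\varphi(\Omega)$ if $E\xi=0$, $E\exp\{\lambda\xi\}$ exists for all $\lambda\in\mathbb R$, and there is $a>0$ with $E\exp\{\lambda\xi\}\le\exp\{\varphi(\lambda a)\}$ for all $\lambda\in\mathbb R$; $Sub_\varphi(\Omega)$ is a Banach space with norm $\tau_\varphi(\xi)=\inf\{a\ge0:E\exp\{\lambda\xi\}\le\exp\{\varphi(\lambda a)\},\ \lambda\in\mathbb R\}$. A process belongs to $Sub_\varphi(\Omega)$ if each of its values does.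
   Formalization: The printed claim fails for p>1, δ<1: the formal one bounds P{∫|X−X_N|^p dμ>δ} by α, and gives the printed conclusion when p=1 or δ≥1. It also assumes f nondecreasing on (0,∞), μ σ-finite and X_N measurable, without which the claim fails or is undefined. *)

theory Defs
  imports "HOL-Probability.Probability"
begin

definition N_function :: "(real \<Rightarrow> real) \<Rightarrow> bool" where
  "N_function \<phi> \<longleftrightarrow>
     continuous_on UNIV \<phi> \<and> (\<forall>x. \<phi> (- x) = \<phi> x) \<and> convex_on UNIV \<phi> \<and>
     strict_mono_on {0<..} \<phi> \<and> \<phi> 0 = 0 \<and>
     ((\<lambda>x. \<phi> x / x) \<longlongrightarrow> 0) (at 0) \<and>
     filterlim (\<lambda>x. \<phi> x / x) at_top at_top"

definition condition_Q :: "(real \<Rightarrow> real) \<Rightarrow> bool" where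
  "condition_Q \<phi> \<longleftrightarrow> Liminf (at 0) (\<lambda>x. ereal (\<phi> x / x\<^sup>2)) > 0"

(* The supremum is finite for every N-function, since \<phi> grows superlinearly. *)
definition young_fenchel :: "(real \<Rightarrow> real) \<Rightarrow> real \<Rightarrow> real" where
  "young_fenchel \<phi> x = (SUP y. x * y - \<phi> y)"

(* The transform is even; as usual, its inverse is that of its restriction to the
   nonnegative half-line. *)
definition young_fenchel_inv :: "(real \<Rightarrow> real) \<Rightarrow> real \<Rightarrow> real" where
  "young_fenchel_inv \<phi> = the_inv_into {0..} (young_fenchel \<phi>)"

definition Sub :: "(real \<Rightarrow> real) \<Rightarrow> 'w measure \<Rightarrow> ('w \<Rightarrow> real) set" where
  "Sub \<phi> P = {\<xi> \<in> borel_measurable P.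
     integrable P \<xi> \<and> integral\<^sup>L P \<xi> = 0 \<and>
     (\<forall>l. integrable P (\<lambda>\<omega>. exp (l * \<xi> \<omega>))) \<and>
     (\<exists>a>0. \<forall>l. integral\<^sup>L P (\<lambda>\<omega>. exp (l * \<xi> \<omega>)) \<le> exp (\<phi> (l * a)))}"

definition tau :: "(real \<Rightarrow> real) \<Rightarrow> 'w measure \<Rightarrow> ('w \<Rightarrow> real) \<Rightarrow> real" where
  "tau \<phi> P \<xi> =
     Inf {a. 0 \<le> a \<and> (\<forall>l. integral\<^sup>L P (\<lambda>\<omega>. exp (l * \<xi> \<omega>)) \<le> exp (\<phi> (l * a)))}"

(* A process is indexed by the points of the measure space \<mu>; it is measurable
   if it is jointly measurable in the index and the sample point. *)
definition measurable_process ::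
  "'t measure \<Rightarrow> 'w measure \<Rightarrow> ('t \<Rightarrow> 'w \<Rightarrow> real) \<Rightarrow> bool" where
  "measurable_process \<mu> P X \<longleftrightarrow> (\<lambda>(t, \<omega>). X t \<omega>) \<in> borel_measurable (\<mu> \<Otimes>\<^sub>M P)"

definition Sub_process ::
  "(real \<Rightarrow> real) \<Rightarrow> 't measure \<Rightarrow> 'w measure \<Rightarrow> ('t \<Rightarrow> 'w \<Rightarrow> real) \<Rightarrow> bool" where
  "Sub_process \<phi> \<mu> P X \<longleftrightarrow> (\<forall>t\<in>space \<mu>. X t \<in> Sub \<phi> P)"

(* Extended-valued: a function that is not p-integrable gets the value \<infinity>. *)
definition Lp_norm :: "'t measure \<Rightarrow> real \<Rightarrow> ('t \<Rightarrow> real) \<Rightarrow> ennreal" where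
  "Lp_norm \<mu> p g = (let I = (\<integral>\<^sup>+ t. ennreal (\<bar>g t\<bar> powr p) \<partial>\<mu>)
     in if I = \<infinity> then \<infinity> else ennreal (enn2real I powr (1 / p)))"

(* Y approximates X with reliability 1 - \<alpha> and accuracy \<epsilon> in L_p. *)
definition approximates ::
  "'t measure \<Rightarrow> 'w measure \<Rightarrow> real \<Rightarrow> ('t \<Rightarrow> 'w \<Rightarrow> real) \<Rightarrow> ('t \<Rightarrow> 'w \<Rightarrow> real)
     \<Rightarrow> real \<Rightarrow> real \<Rightarrow> bool" where
  "approximates \<mu> P p X Y \<alpha> \<epsilon> \<longleftrightarrow>
     measure P {\<omega> \<in> space P. Lp_norm \<mu> p (\<lambda>t. X t \<omega> - Y t \<omega>) > ennreal \<epsilon>} \<le> \<alpha>"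

end

theory Submission
  imports Defs
begin

text \<open>
  Let \<open>Y = X - XN\<close>, let \<open>\<tau> t\<close> be the norm of \<open>Y t\<close>, and let \<open>x = (\<delta> / cN) powr (1 / p)\<close>. The
  normalised process \<open>Z = \<bar>Y\<bar> / \<tau>\<close> satisfies \<open>E exp (\<theta> Z t) \<le> 2 exp (\<phi> \<theta>)\<close> wherever
  \<open>\<tau> t > 0\<close>, and \<open>\<integral> \<bar>Y\<bar> powr p d\<mu> > \<delta>\<close> says that the mean of \<open>Z powr p\<close> with respect to the
  probability measure \<open>\<tau> powr p d\<mu> / cN\<close> exceeds \<open>x powr p\<close>. The function
  \<open>exp (\<theta> (z - x))\<close> lies above \<open>1 + k ((z / x) powr p - 1)\<close>, where \<open>k = \<theta> x / p\<close>, as soon as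
  \<open>k \<ge> 1\<close>. Averaging this over \<open>t\<close> and then taking expectations gives
  the probability bound \<open>2 exp (\<phi> \<theta> - \<theta> x)\<close> for every \<open>\<theta> \<ge> p / x\<close>
  (\<open>power_integral_tail_le\<close>).

  Optimising over all \<open>\<theta>\<close> would give \<open>2 exp (- \<phi>\<^sup>* x)\<close>. The constraint \<open>\<theta> \<ge> p / x\<close>
  costs nothing: the strict lower bound on \<open>\<delta>\<close> says \<open>f (p / x) < x\<close>, so
  \<open>\<theta> \<mapsto> \<theta> x - \<phi> \<theta>\<close>, the integral of \<open>x - f\<close>, still increases up to \<open>p / x\<close>
  (\<open>young_fenchel_least_right\<close>). The upper bound on \<open>cN\<close> says that \<open>x\<close> is at least the point at
  which \<open>\<phi>\<^sup>*\<close> takes the value \<open>ln (2 / \<alpha>)\<close>, and \<open>\<phi>\<^sup>*\<close> is increasing on the nonnegative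
  half-line, so that \<open>2 exp (- \<phi>\<^sup>* x) \<le> \<alpha>\<close>.

  If \<open>cN = 0\<close>, then \<open>Y t = 0\<close> almost surely for almost every \<open>t\<close>, and the integral vanishes
  almost surely.
\<close>

section \<open>N-functions and their Young-Fenchel transforms\<close>

lemma N_function_nonneg:
  assumes "N_function \<phi>"
  shows "0 \<le> \<phi> x"
proof -
  have "\<phi> ((1 - 1/2) *\<^sub>R x + (1/2) *\<^sub>R (- x)) \<le> (1 - 1/2) * \<phi> x + (1/2) * \<phi> (- x)"
    using assms by (intro convex_onD[of UNIV]) (auto simp: N_function_def)
  then show ?thesis
    using assms by (simp add: N_function_def)
qed

lemma N_function_abs:
  assumes "N_function \<phi>"
  shows "\<phi> \<bar>x\<bar> = \<phi> x"
  using assms by (simp add: N_function_def abs_if)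

lemma N_function_mono:
  assumes "N_function \<phi>" "\<bar>x\<bar> \<le> \<bar>y\<bar>"
  shows "\<phi> x \<le> \<phi> y"
proof -
  have "\<phi> \<bar>x\<bar> \<le> \<phi> \<bar>y\<bar>"
  proof (cases "x = 0 \<or> \<bar>x\<bar> = \<bar>y\<bar>")
    case True
    then show ?thesis
      using assms(1) N_function_nonneg[OF assms(1), of "\<bar>y\<bar>"] by (auto simp: N_function_def)
  next
    case False
    then have "\<phi> \<bar>x\<bar> < \<phi> \<bar>y\<bar>"
      using assms by (auto simp: N_function_def intro!: strict_mono_onD[of "{0<..}" \<phi>])
    then show ?thesis by simp
  qed
  then show ?thesis by (simp add: N_function_abs[OF assms(1)])
qed

lemma N_function_mono_scaled:
  assumes "N_function \<phi>" "0 \<le> a" "a \<le> b"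
  shows "\<phi> (l * a) \<le> \<phi> (l * b)"
  using assms(2,3) by (intro N_function_mono[OF assms(1)]) (simp add: abs_mult mult_left_mono)

text \<open>Superlinear growth makes \<open>x y - \<phi> y\<close> nonpositive for large \<open>\<bar>y\<bar>\<close>. Without this bound the
  real-valued supremum in \<open>young_fenchel\<close> would be an unspecified number.\<close>

lemma bdd_above_young_fenchel:
  assumes "N_function \<phi>"
  shows "bdd_above (range (\<lambda>y. x * y - \<phi> y))"
proof -
  have "filterlim (\<lambda>y. \<phi> y / y) at_top at_top"
    using assms by (simp add: N_function_def)
  then have "eventually (\<lambda>y. \<phi> y / y \<ge> \<bar>x\<bar>) at_top"
    by (simp add: filterlim_at_top)
  then obtain b0 where b0: "\<And>y. y \<ge> b0 \<Longrightarrow> \<phi> y / y \<ge> \<bar>x\<bar>"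
    by (auto simp: eventually_at_top_linorder)
  define b where "b = max b0 1"
  have "x * y - \<phi> y \<le> \<bar>x\<bar> * b" for y
  proof -
    have xy: "x * y \<le> \<bar>x\<bar> * \<bar>y\<bar>" by (metis abs_ge_self abs_mult)
    show ?thesis
    proof (cases "\<bar>y\<bar> \<le> b")
      case True
      then have "\<bar>x\<bar> * \<bar>y\<bar> \<le> \<bar>x\<bar> * b" by (intro mult_left_mono) auto
      then show ?thesis using xy N_function_nonneg[OF assms, of y] by linarith
    next
      case False
      then have "\<phi> \<bar>y\<bar> / \<bar>y\<bar> \<ge> \<bar>x\<bar>" "\<bar>y\<bar> > 0" using b0[of "\<bar>y\<bar>"] by (auto simp: b_def)
      then have "\<phi> y \<ge> \<bar>x\<bar> * \<bar>y\<bar>"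
        by (simp add: N_function_abs[OF assms] field_simps)
      moreover have "0 \<le> \<bar>x\<bar> * b" by (simp add: b_def)
      ultimately show ?thesis using xy by linarith
    qed
  qed
  then show ?thesis by (auto simp: bdd_above_def)
qed

lemma young_fenchel_upper:
  assumes "N_function \<phi>"
  shows "x * y - \<phi> y \<le> young_fenchel \<phi> x"
  unfolding young_fenchel_def
  by (rule cSUP_upper[OF UNIV_I bdd_above_young_fenchel[OF assms]])

lemma young_fenchel_least:
  assumes "\<And>y. x * y - \<phi> y \<le> c"
  shows "young_fenchel \<phi> x \<le> c"
  unfolding young_fenchel_def using assms by (intro cSUP_least) auto

lemma young_fenchel_0:
  assumes "N_function \<phi>"
  shows "young_fenchel \<phi> 0 = 0"
proof (rule antisym)
  show "young_fenchel \<phi> 0 \<le> 0"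
    using N_function_nonneg[OF assms] by (intro young_fenchel_least) simp
  show "0 \<le> young_fenchel \<phi> 0"
    using young_fenchel_upper[OF assms, of 0 0] assms by (simp add: N_function_def)
qed

text \<open>Since \<open>\<phi> y / y\<close> tends to \<open>0\<close>, the line of slope \<open>x\<close> lies above the graph of \<open>\<phi>\<close> at
  small positive arguments.\<close>

lemma young_fenchel_pos:
  assumes "N_function \<phi>" "0 < x"
  shows "0 < young_fenchel \<phi> x"
proof -
  have "((\<lambda>y. \<phi> y / y) \<longlongrightarrow> 0) (at_right 0)"
    using assms(1) by (auto simp: N_function_def intro: tendsto_within_subset)
  then have "eventually (\<lambda>y. \<phi> y / y < x) (at_right 0)"
    using assms(2) by (rule order_tendstoD)
  moreover have "eventually (\<lambda>y::real. 0 < y) (at_right 0)"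
    by (simp add: eventually_at_right_less)
  ultimately have "eventually (\<lambda>y. 0 < y \<and> \<phi> y / y < x) (at_right 0)"
    by eventually_elim simp
  then obtain y where "0 < y" "\<phi> y / y < x"
    using eventually_happens' [of "at_right (0::real)"] by auto
  then have "0 < x * y - \<phi> y" by (simp add: field_simps)
  then show ?thesis using young_fenchel_upper[OF assms(1), of x y] by linarith
qed

lemma convex_young_fenchel:
  assumes "N_function \<phi>"
  shows "convex_on UNIV (young_fenchel \<phi>)"
proof (rule convex_onI)
  fix t x z :: real assume t: "0 < t" "t < 1"
  show "young_fenchel \<phi> ((1 - t) *\<^sub>R x + t *\<^sub>R z)
      \<le> (1 - t) * young_fenchel \<phi> x + t * young_fenchel \<phi> z"
  proof (rule young_fenchel_least)
    fix y
    have "(1 - t) * (x * y - \<phi> y) + t * (z * y - \<phi> y)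
        \<le> (1 - t) * young_fenchel \<phi> x + t * young_fenchel \<phi> z"
      using t by (intro add_mono mult_left_mono young_fenchel_upper[OF assms]) auto
    then show "((1 - t) *\<^sub>R x + t *\<^sub>R z) * y - \<phi> y
        \<le> (1 - t) * young_fenchel \<phi> x + t * young_fenchel \<phi> z"
      by (simp add: algebra_simps)
  qed
qed simp

text \<open>A convex function that vanishes at \<open>0\<close> satisfies \<open>g x \<le> (x / z) g z\<close> for
  \<open>0 \<le> x < z\<close>, and here \<open>g z > 0\<close>.\<close>

lemma strict_mono_on_young_fenchel:
  assumes "N_function \<phi>"
  shows "strict_mono_on {0..} (young_fenchel \<phi>)"
proof (rule strict_mono_onI)
  fix x z :: real assume "x \<in> {0..}" "z \<in> {0..}" "x < z"
  then have x: "0 \<le> x" "0 < z" "x / z < 1" "x < z" by auto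
  have "young_fenchel \<phi> ((1 - x / z) *\<^sub>R 0 + (x / z) *\<^sub>R z)
      \<le> (1 - x / z) * young_fenchel \<phi> 0 + (x / z) * young_fenchel \<phi> z"
    using x by (intro convex_onD[OF convex_young_fenchel[OF assms]]) auto
  then have "young_fenchel \<phi> x \<le> (x / z) * young_fenchel \<phi> z"
    using x by (simp add: young_fenchel_0[OF assms])
  also have "\<dots> < 1 * young_fenchel \<phi> z"
    using x young_fenchel_pos[OF assms] by (intro mult_strict_right_mono) auto
  finally show "young_fenchel \<phi> x < young_fenchel \<phi> z" by simp
qed

text \<open>The intermediate value theorem applies on \<open>[0, b]\<close> with \<open>b = L + \<phi> 1\<close>, because the
  point \<open>y = 1\<close> in the supremum gives \<open>\<phi>\<^sup>* b \<ge> b - \<phi> 1 = L\<close>.\<close>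

lemma young_fenchel_inv_correct:
  assumes "N_function \<phi>" "0 < L"
  shows "0 < young_fenchel_inv \<phi> L" "young_fenchel \<phi> (young_fenchel_inv \<phi> L) = L"
proof -
  have inj: "inj_on (young_fenchel \<phi>) {0..}"
    using strict_mono_on_young_fenchel[OF assms(1)] by (rule strict_mono_on_imp_inj_on)
  define b where "b = L + \<phi> 1"
  have b: "0 \<le> b" "L \<le> young_fenchel \<phi> b"
    using assms young_fenchel_upper[OF assms(1), of b 1] N_function_nonneg[OF assms(1), of 1]
    by (auto simp: b_def)
  have "continuous_on UNIV (young_fenchel \<phi>)"
    using convex_young_fenchel[OF assms(1)] by (intro convex_on_continuous) auto
  then have "continuous_on {0..b} (young_fenchel \<phi>)"
    by (rule continuous_on_subset) simp
  then obtain x where x: "0 \<le> x" "young_fenchel \<phi> x = L"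
    using IVT'[of "young_fenchel \<phi>" 0 L b] b assms young_fenchel_0[OF assms(1)] by auto
  then have v: "young_fenchel_inv \<phi> L = x"
    unfolding young_fenchel_inv_def using the_inv_into_f_f[OF inj, of x] by simp
  show "young_fenchel \<phi> (young_fenchel_inv \<phi> L) = L" using v x by simp
  show "0 < young_fenchel_inv \<phi> L"
    using v x assms(2) young_fenchel_0[OF assms(1)] by (cases "x = 0") auto
qed

text \<open>A nondecreasing density \<open>f\<close> of \<open>\<phi>\<close> bounds the increments of \<open>\<phi>\<close> to the left of
  a point \<open>b\<close> by \<open>f b\<close>. Hence, once the slope \<open>x\<close> is at least \<open>f b\<close>, the function
  \<open>y \<mapsto> x y - \<phi> y\<close> does not decrease on the way to \<open>b\<close>, and its supremum can be
  sought among \<open>y \<ge> b\<close> only.\<close>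

lemma young_fenchel_least_right:
  assumes \<phi>: "N_function \<phi>"
    and f: "mono_on {0<..} f" "\<And>u. 0 < u \<Longrightarrow> (f has_integral \<phi> u) {0..u}"
    and b: "0 < b" "f b \<le> x"
    and le: "\<And>y. b \<le> y \<Longrightarrow> x * y - \<phi> y \<le> c"
  shows "young_fenchel \<phi> x \<le> c"
proof (rule young_fenchel_least)
  fix y :: real
  define a where "a = max 0 y"
  have incr: "\<phi> b - \<phi> a \<le> x * (b - a)" if "0 \<le> a" "a \<le> b" for a
  proof -
    have fa: "(f has_integral \<phi> a) {0..a}"
      using f(2)[of a] that \<phi> by (cases "a = 0") (auto simp: N_function_def)
    have "f integrable_on {a..b}"
      using that by (intro integrable_on_subinterval[OF has_integral_integrable[OF f(2)[OF b(1)]]]) auto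
    then obtain I where I: "(f has_integral I) {a..b}" by auto
    have "(f has_integral (\<phi> a + I)) {0..b}"
      using that fa I by (metis has_integral_combine)
    then have eq: "\<phi> b = \<phi> a + I" using f(2)[OF b(1)] has_integral_unique by blast
    \<comment> \<open>\<open>f 0\<close> is arbitrary: monotonicity is known on the open half-line only.\<close>
    have "((\<lambda>v. if v = 0 then x else f v) has_integral I) {a..b}"
      using I by (rule has_integral_spike_finite[of "{0}", rotated 2]) auto
    moreover have "((\<lambda>v. x) has_integral (b - a) *\<^sub>R x) {a..b}"
      using has_integral_const_real[of x a b] that by simp
    ultimately have "I \<le> (b - a) *\<^sub>R x"
    proof (rule has_integral_le)
      fix v assume "v \<in> {a..b}"
      then have "f v \<le> f b" if "v \<noteq> 0"
        using that \<open>0 \<le> a\<close> b by (intro mono_onD[OF f(1)]) auto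
      then show "(if v = 0 then x else f v) \<le> x" using b by auto
    qed
    then show ?thesis using eq by (simp add: algebra_simps)
  qed
  show "x * y - \<phi> y \<le> c"
  proof (cases "b \<le> y")
    case True
    then show ?thesis by (rule le)
  next
    case False
    then have a: "0 \<le> a" "a \<le> b" using b by (auto simp: a_def)
    have "0 \<le> x"
    proof -
      have "0 \<le> x * b"
        using incr[of 0] b N_function_nonneg[OF \<phi>, of b] \<phi> by (simp add: N_function_def)
      then show ?thesis using b by (simp add: zero_le_mult_iff)
    qed
    then have "x * y \<le> x * a" by (intro mult_left_mono) (auto simp: a_def)
    moreover have "\<phi> a \<le> \<phi> y" by (intro N_function_mono[OF \<phi>]) (auto simp: a_def)
    ultimately have "x * y - \<phi> y \<le> x * a - \<phi> a" by linarith
    also have "\<dots> \<le> x * b - \<phi> b" using incr[OF a] by (simp add: algebra_simps)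
    also have "\<dots> \<le> c" by (rule le) simp
    finally show ?thesis .
  qed
qed

section \<open>Random variables with a dominated moment generating function\<close>

definition mgf_dominators :: "(real \<Rightarrow> real) \<Rightarrow> 'w measure \<Rightarrow> ('w \<Rightarrow> real) \<Rightarrow> real set" where
  "mgf_dominators \<phi> P \<xi> =
     {a. 0 \<le> a \<and> (\<forall>l. integral\<^sup>L P (\<lambda>\<omega>. exp (l * \<xi> \<omega>)) \<le> exp (\<phi> (l * a)))}"

lemma tau_eq_Inf_mgf_dominators: "tau \<phi> P \<xi> = Inf (mgf_dominators \<phi> P \<xi>)"
  by (simp add: tau_def mgf_dominators_def)

lemma bdd_below_mgf_dominators: "bdd_below (mgf_dominators \<phi> P \<xi>)"
  unfolding bdd_below_def mgf_dominators_def by blast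

lemma continuous_on_N_function:
  assumes "N_function \<phi>" "continuous_on S g"
  shows "continuous_on S (\<lambda>x. \<phi> (g x))"
proof -
  have "continuous_on UNIV \<phi>" using assms(1) by (simp add: N_function_def)
  then show ?thesis by (rule continuous_on_compose2[OF _ assms(2)]) simp
qed

lemma closed_mgf_dominators:
  assumes "N_function \<phi>"
  shows "closed (mgf_dominators \<phi> P \<xi>)"
proof -
  have "closed {a. integral\<^sup>L P (\<lambda>\<omega>. exp (l * \<xi> \<omega>)) \<le> exp (\<phi> (l * a))}" for l
    by (rule closed_Collect_le[OF continuous_on_const])
       (intro continuous_on_exp continuous_on_N_function[OF assms] continuous_intros)
  then have "closed ({0..} \<inter> (\<Inter>l. {a. integral\<^sup>L P (\<lambda>\<omega>. exp (l * \<xi> \<omega>)) \<le> exp (\<phi> (l * a))}))"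
    by (intro closed_Int closed_INT ballI closed_atLeast)
  moreover have "mgf_dominators \<phi> P \<xi>
      = {0..} \<inter> (\<Inter>l. {a. integral\<^sup>L P (\<lambda>\<omega>. exp (l * \<xi> \<omega>)) \<le> exp (\<phi> (l * a))})"
    unfolding mgf_dominators_def by blast
  ultimately show ?thesis by simp
qed

text \<open>The dominators form a closed set, so the infimum \<open>tau\<close> is attained and may itself be
  used as the scale in \<open>E exp (l \<xi>) \<le> exp (\<phi> (l a))\<close>.\<close>

lemma tau_in_mgf_dominators:
  assumes "N_function \<phi>" "mgf_dominators \<phi> P \<xi> \<noteq> {}"
  shows "tau \<phi> P \<xi> \<in> mgf_dominators \<phi> P \<xi>"
proof -
  show ?thesis
    unfolding tau_eq_Inf_mgf_dominators
    by (rule closed_contains_Inf[OF assms(2) bdd_below_mgf_dominators closed_mgf_dominators[OF assms(1)]])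
qed

lemma tau_le_iff:
  assumes "N_function \<phi>" "mgf_dominators \<phi> P \<xi> \<noteq> {}" "0 \<le> a"
  shows "tau \<phi> P \<xi> \<le> a \<longleftrightarrow> a \<in> mgf_dominators \<phi> P \<xi>"
proof
  assume le: "tau \<phi> P \<xi> \<le> a"
  note tau = tau_in_mgf_dominators[OF assms(1,2)]
  have tau0: "0 \<le> tau \<phi> P \<xi>"
    and dom: "\<And>l. integral\<^sup>L P (\<lambda>\<omega>. exp (l * \<xi> \<omega>)) \<le> exp (\<phi> (l * tau \<phi> P \<xi>))"
    using tau by (auto simp: mgf_dominators_def)
  have "integral\<^sup>L P (\<lambda>\<omega>. exp (l * \<xi> \<omega>)) \<le> exp (\<phi> (l * a))" for l
    using dom[of l] N_function_mono_scaled[OF assms(1) tau0 le, of l] order_trans by fastforce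
  then show "a \<in> mgf_dominators \<phi> P \<xi>"
    using assms(3) by (simp add: mgf_dominators_def)
next
  assume "a \<in> mgf_dominators \<phi> P \<xi>"
  then show "tau \<phi> P \<xi> \<le> a"
    unfolding tau_eq_Inf_mgf_dominators
    by (rule cInf_lower[OF _ bdd_below_mgf_dominators])
qed

text \<open>Since \<open>exp (l (\<xi> - \<eta>)) \<le> (exp (2 l \<xi>) + exp (- 2 l \<eta>)) / 2\<close>, twice the larger of two
  dominators of \<open>\<xi>\<close> and \<open>\<eta>\<close> dominates the difference.\<close>

lemma Sub_diff:
  assumes \<phi>: "N_function \<phi>" and \<xi>: "\<xi> \<in> Sub \<phi> P" and \<eta>: "\<eta> \<in> Sub \<phi> P"
  shows "integrable P (\<lambda>\<omega>. exp (l * (\<xi> \<omega> - \<eta> \<omega>)))"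
    and "mgf_dominators \<phi> P (\<lambda>\<omega>. \<xi> \<omega> - \<eta> \<omega>) \<noteq> {}"
proof -
  obtain a where a: "0 < a" "\<And>l. integral\<^sup>L P (\<lambda>\<omega>. exp (l * \<xi> \<omega>)) \<le> exp (\<phi> (l * a))"
    using \<xi> unfolding Sub_def by blast
  obtain b where b: "0 < b" "\<And>l. integral\<^sup>L P (\<lambda>\<omega>. exp (l * \<eta> \<omega>)) \<le> exp (\<phi> (l * b))"
    using \<eta> unfolding Sub_def by blast
  have meas[measurable]: "\<xi> \<in> borel_measurable P" "\<eta> \<in> borel_measurable P"
    using \<xi> \<eta> by (auto simp: Sub_def)
  have int: "integrable P (\<lambda>\<omega>. exp (l * \<xi> \<omega>))" "integrable P (\<lambda>\<omega>. exp (l * \<eta> \<omega>))" for l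
    using \<xi> \<eta> by (auto simp: Sub_def)
  have amgm: "exp (l * (\<xi> \<omega> - \<eta> \<omega>)) \<le> (exp (2 * l * \<xi> \<omega>) + exp (- 2 * l * \<eta> \<omega>)) / 2" for l \<omega>
  proof -
    have "0 \<le> (exp (l * \<xi> \<omega>) - exp (- l * \<eta> \<omega>))\<^sup>2" by simp
    also have "\<dots> = exp (l * \<xi> \<omega> + l * \<xi> \<omega>) + exp (- l * \<eta> \<omega> + - l * \<eta> \<omega>)
        - 2 * exp (l * \<xi> \<omega> + - l * \<eta> \<omega>)"
      unfolding exp_add power2_eq_square by (simp add: algebra_simps)
    also have "\<dots> = exp (2 * l * \<xi> \<omega>) + exp (- 2 * l * \<eta> \<omega>) - 2 * exp (l * (\<xi> \<omega> - \<eta> \<omega>))"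
      by (simp add: algebra_simps)
    finally show ?thesis by simp
  qed
  have int2: "integrable P (\<lambda>\<omega>. (exp (2 * l * \<xi> \<omega>) + exp (- 2 * l * \<eta> \<omega>)) / 2)" for l
    by (intro integrable_divide_zero Bochner_Integration.integrable_add int)
  show int_diff: "integrable P (\<lambda>\<omega>. exp (l * (\<xi> \<omega> - \<eta> \<omega>)))" for l
    using amgm by (intro Bochner_Integration.integrable_bound[OF int2[of l]]) auto
  have "2 * max a b \<in> mgf_dominators \<phi> P (\<lambda>\<omega>. \<xi> \<omega> - \<eta> \<omega>)"
    unfolding mgf_dominators_def
  proof (intro CollectI conjI allI)
    fix l
    have "integral\<^sup>L P (\<lambda>\<omega>. exp (l * (\<xi> \<omega> - \<eta> \<omega>)))
        \<le> integral\<^sup>L P (\<lambda>\<omega>. (exp (2 * l * \<xi> \<omega>) + exp (- 2 * l * \<eta> \<omega>)) / 2)"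
      by (intro integral_mono int_diff int2 amgm)
    also have "\<dots> = (integral\<^sup>L P (\<lambda>\<omega>. exp (2 * l * \<xi> \<omega>)) + integral\<^sup>L P (\<lambda>\<omega>. exp (- 2 * l * \<eta> \<omega>))) / 2"
      using int(1)[of "2*l"] int(2)[of "-2*l"] by (simp add: Bochner_Integration.integral_add)
    also have "\<dots> \<le> (exp (\<phi> (2 * l * a)) + exp (\<phi> (- 2 * l * b))) / 2"
      by (intro divide_right_mono add_mono a b) auto
    also have "\<dots> \<le> (exp (\<phi> (l * (2 * max a b))) + exp (\<phi> (l * (2 * max a b)))) / 2"
    proof (intro divide_right_mono add_mono)
      have "\<phi> (l * (2 * a)) \<le> \<phi> (l * (2 * max a b))"
        using a(1) by (intro N_function_mono_scaled[OF \<phi>]) auto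
      then show "exp (\<phi> (2 * l * a)) \<le> exp (\<phi> (l * (2 * max a b)))"
        by (simp add: ac_simps)
      have "\<phi> (- l * (2 * b)) \<le> \<phi> (- l * (2 * max a b))"
        using b(1) by (intro N_function_mono_scaled[OF \<phi>]) auto
      then show "exp (\<phi> (- 2 * l * b)) \<le> exp (\<phi> (l * (2 * max a b)))"
        using \<phi> by (simp add: ac_simps N_function_def)
    qed simp
    finally show "integral\<^sup>L P (\<lambda>\<omega>. exp (l * (\<xi> \<omega> - \<eta> \<omega>))) \<le> exp (\<phi> (l * (2 * max a b)))"
      by simp
  qed (use a in auto)
  then show "mgf_dominators \<phi> P (\<lambda>\<omega>. \<xi> \<omega> - \<eta> \<omega>) \<noteq> {}" by blast
qed

text \<open>A moment generating function is convex, and a finite convex function is continuous.\<close>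

lemma continuous_mgf:
  fixes \<xi> :: "'w \<Rightarrow> real"
  assumes int: "\<And>l. integrable P (\<lambda>\<omega>. exp (l * \<xi> \<omega>))"
  shows "continuous_on UNIV (\<lambda>l. integral\<^sup>L P (\<lambda>\<omega>. exp (l * \<xi> \<omega>)))"
proof (rule convex_on_continuous[OF open_UNIV])
  show "convex_on UNIV (\<lambda>l. integral\<^sup>L P (\<lambda>\<omega>. exp (l * \<xi> \<omega>)))"
  proof (rule convex_onI)
    fix t x y :: real assume t: "0 < t" "t < 1"
    have "integral\<^sup>L P (\<lambda>\<omega>. exp (((1 - t) *\<^sub>R x + t *\<^sub>R y) * \<xi> \<omega>))
        \<le> integral\<^sup>L P (\<lambda>\<omega>. (1 - t) * exp (x * \<xi> \<omega>) + t * exp (y * \<xi> \<omega>))"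
    proof (intro integral_mono int Bochner_Integration.integrable_add integrable_mult_right)
      fix \<omega>
      have "exp ((1 - t) *\<^sub>R (x * \<xi> \<omega>) + t *\<^sub>R (y * \<xi> \<omega>)) \<le> (1 - t) * exp (x * \<xi> \<omega>) + t * exp (y * \<xi> \<omega>)"
        using t by (intro convex_onD[OF exp_convex]) auto
      then show "exp (((1 - t) *\<^sub>R x + t *\<^sub>R y) * \<xi> \<omega>) \<le> (1 - t) * exp (x * \<xi> \<omega>) + t * exp (y * \<xi> \<omega>)"
        by (simp add: algebra_simps)
    qed
    then show "integral\<^sup>L P (\<lambda>\<omega>. exp (((1 - t) *\<^sub>R x + t *\<^sub>R y) * \<xi> \<omega>))
        \<le> (1 - t) * integral\<^sup>L P (\<lambda>\<omega>. exp (x * \<xi> \<omega>)) + t * integral\<^sup>L P (\<lambda>\<omega>. exp (y * \<xi> \<omega>))"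
      using int by simp
  qed simp
qed

text \<open>By continuity in \<open>l\<close>. Only countably many conditions remain, which makes
  \<open>t \<mapsto> tau \<phi> P (Y t)\<close> measurable for a measurable process \<open>Y\<close>.\<close>

lemma mgf_dominators_rational:
  assumes \<phi>: "N_function \<phi>" and int: "\<And>l. integrable P (\<lambda>\<omega>. exp (l * \<xi> \<omega>))"
  shows "mgf_dominators \<phi> P \<xi> =
    {a. 0 \<le> a \<and> (\<forall>l\<in>\<rat>. integral\<^sup>L P (\<lambda>\<omega>. exp (l * \<xi> \<omega>)) \<le> exp (\<phi> (l * a)))}"
proof -
  have "integral\<^sup>L P (\<lambda>\<omega>. exp (l * \<xi> \<omega>)) \<le> exp (\<phi> (l * a))"
    if *: "\<forall>l\<in>\<rat>. integral\<^sup>L P (\<lambda>\<omega>. exp (l * \<xi> \<omega>)) \<le> exp (\<phi> (l * a))" for a l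
  proof -
    have "continuous_on UNIV (\<lambda>l. exp (\<phi> (l * a)))"
      by (intro continuous_on_exp continuous_on_N_function[OF \<phi>] continuous_intros)
    then have "closed {l. integral\<^sup>L P (\<lambda>\<omega>. exp (l * \<xi> \<omega>)) \<le> exp (\<phi> (l * a))}"
      by (rule closed_Collect_le[OF continuous_mgf[OF int]])
    then have "closure \<rat> \<subseteq> {l. integral\<^sup>L P (\<lambda>\<omega>. exp (l * \<xi> \<omega>)) \<le> exp (\<phi> (l * a))}"
      using * by (intro closure_minimal) auto
    then show ?thesis by (auto simp: Rats_closure_real)
  qed
  then show ?thesis by (auto simp: mgf_dominators_def)
qed

text \<open>If the norm vanishes, then \<open>exp \<xi>\<close> and \<open>exp (- \<xi>)\<close> both have mean at most \<open>1\<close>,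
  whereas \<open>exp \<xi> + exp (- \<xi>) \<ge> 2\<close> with equality only for \<open>\<xi> = 0\<close>.\<close>

lemma (in prob_space) tau_zero_imp_AE_zero:
  assumes \<phi>: "N_function \<phi>" and int: "\<And>l. integrable M (\<lambda>\<omega>. exp (l * \<xi> \<omega>))"
    and ne: "mgf_dominators \<phi> M \<xi> \<noteq> {}" and tau: "tau \<phi> M \<xi> = 0"
  shows "AE \<omega> in M. \<xi> \<omega> = 0"
proof -
  define g where "g = (\<lambda>\<omega>. exp (1 * \<xi> \<omega>) + exp (- 1 * \<xi> \<omega>) - 2)"
  have sq: "g \<omega> = (exp (\<xi> \<omega> / 2) - exp (- \<xi> \<omega> / 2))\<^sup>2" for \<omega>
  proof -
    have "g \<omega> = exp (\<xi> \<omega> / 2 + \<xi> \<omega> / 2) + exp (- \<xi> \<omega> / 2 + - \<xi> \<omega> / 2)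
        - 2 * exp (\<xi> \<omega> / 2 + - \<xi> \<omega> / 2)"
      by (simp add: g_def)
    then show ?thesis
      unfolding exp_add power2_eq_square by (simp add: algebra_simps)
  qed
  have g_int: "integrable M g"
    unfolding g_def by (intro Bochner_Integration.integrable_diff Bochner_Integration.integrable_add int) simp
  have le: "expectation (\<lambda>\<omega>. exp (l * \<xi> \<omega>)) \<le> 1" for l
  proof -
    have "0 \<in> mgf_dominators \<phi> M \<xi>" using tau_in_mgf_dominators[OF \<phi> ne] tau by simp
    moreover have "\<phi> 0 = 0" using \<phi> by (simp add: N_function_def)
    ultimately show ?thesis by (simp add: mgf_dominators_def)
  qed
  have "integral\<^sup>L M g = expectation (\<lambda>\<omega>. exp (1 * \<xi> \<omega>)) + expectation (\<lambda>\<omega>. exp (- 1 * \<xi> \<omega>)) - 2"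
    unfolding g_def using int[of 1] int[of "-1"]
    by (simp add: Bochner_Integration.integral_diff Bochner_Integration.integral_add prob_space)
  also have "\<dots> \<le> 0" using le[of 1] le[of "-1"] by linarith
  finally have "integral\<^sup>L M g \<le> 0" .
  moreover have "0 \<le> integral\<^sup>L M g" by (simp add: sq)
  ultimately have "integral\<^sup>L M g = 0" by linarith
  then have "AE \<omega> in M. g \<omega> = 0"
    using integral_nonneg_eq_0_iff_AE[OF g_int] by (auto simp: sq)
  then show ?thesis
    by eventually_elim (simp add: sq)
qed

text \<open>From \<open>exp \<bar>u\<bar> \<le> exp u + exp (- u)\<close>; this is the origin of the factor \<open>2\<close> in the final
  bound.\<close>

lemma nn_integral_exp_abs_le:
  assumes \<phi>: "N_function \<phi>" and int: "\<And>l. integrable P (\<lambda>\<omega>. exp (l * \<xi> \<omega>))"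
    and ne: "mgf_dominators \<phi> P \<xi> \<noteq> {}" and tau: "0 < tau \<phi> P \<xi>"
  shows "(\<integral>\<^sup>+ \<omega>. ennreal (exp (\<theta> * (\<bar>\<xi> \<omega>\<bar> / tau \<phi> P \<xi>))) \<partial>P) \<le> ennreal (2 * exp (\<phi> \<theta>))"
proof -
  define s where "s = tau \<phi> P \<xi>"
  have s: "0 < s" "\<And>l. integral\<^sup>L P (\<lambda>\<omega>. exp (l * \<xi> \<omega>)) \<le> exp (\<phi> (l * s))"
    using tau_in_mgf_dominators[OF \<phi> ne] tau unfolding mgf_dominators_def s_def by blast+
  have le: "integral\<^sup>L P (\<lambda>\<omega>. exp ((\<theta> / s) * \<xi> \<omega>)) \<le> exp (\<phi> \<theta>)"
    "integral\<^sup>L P (\<lambda>\<omega>. exp ((- \<theta> / s) * \<xi> \<omega>)) \<le> exp (\<phi> \<theta>)"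
    using s(1) s(2)[of "\<theta> / s"] s(2)[of "- \<theta> / s"] \<phi> by (simp_all add: N_function_def)
  have "(\<integral>\<^sup>+ \<omega>. ennreal (exp (\<theta> * (\<bar>\<xi> \<omega>\<bar> / s))) \<partial>P)
      \<le> (\<integral>\<^sup>+ \<omega>. ennreal (exp ((\<theta> / s) * \<xi> \<omega>) + exp ((- \<theta> / s) * \<xi> \<omega>)) \<partial>P)"
    by (intro nn_integral_mono ennreal_leI) (auto simp: abs_if)
  also have "\<dots> = ennreal (integral\<^sup>L P (\<lambda>\<omega>. exp ((\<theta> / s) * \<xi> \<omega>) + exp ((- \<theta> / s) * \<xi> \<omega>)))"
    by (intro nn_integral_eq_integral Bochner_Integration.integrable_add int) (auto intro!: AE_I2 add_nonneg_nonneg)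
  also have "\<dots> = ennreal (integral\<^sup>L P (\<lambda>\<omega>. exp ((\<theta> / s) * \<xi> \<omega>)) + integral\<^sup>L P (\<lambda>\<omega>. exp ((- \<theta> / s) * \<xi> \<omega>)))"
    by (subst Bochner_Integration.integral_add[OF int int]) simp
  also have "\<dots> \<le> ennreal (2 * exp (\<phi> \<theta>))"
    using le by (intro ennreal_leI) linarith
  finally show ?thesis by (simp add: s_def)
qed

section \<open>Tails of the integral of a process\<close>

text \<open>The logarithmic inequality \<open>ln w \<le> w - 1\<close> yields \<open>w powr p \<le> exp u\<close> for \<open>u = p (w - 1)\<close>,
  and by convexity the chord of \<open>exp\<close> between \<open>0\<close> and \<open>k u\<close> lies above \<open>exp u\<close>. The bound is
  affine in \<open>w powr p\<close>, so it can be integrated without a further use of convexity.\<close>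

lemma powr_le_exp_chord:
  fixes w k p :: real
  assumes "0 \<le> w" "1 \<le> k" "0 \<le> p"
  shows "k * w powr p \<le> exp (k * (p * (w - 1))) + (k - 1)"
proof -
  define u where "u = p * (w - 1)"
  have "exp ((1 - 1 / k) *\<^sub>R 0 + (1 / k) *\<^sub>R (k * u)) \<le> (1 - 1 / k) * exp 0 + (1 / k) * exp (k * u)"
    using assms(2) by (intro convex_onD[OF exp_convex]) auto
  then have "k * exp u \<le> k * ((1 - 1 / k) + (1 / k) * exp (k * u))"
    using assms(2) by (intro mult_left_mono) auto
  also have "\<dots> = exp (k * u) + (k - 1)"
    using assms(2) by (simp add: field_simps)
  finally have "k * exp u \<le> exp (k * u) + (k - 1)" .
  moreover have "w powr p \<le> exp u"
  proof (cases "w = 0")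
    case False
    then have "ln w \<le> w - 1" using assms(1) by (intro ln_le_minus_one) simp
    then have "p * ln w \<le> u" using assms(3) by (simp add: u_def mult_left_mono)
    then show ?thesis using False by (simp add: powr_def)
  qed simp
  then have "k * w powr p \<le> k * exp u" using assms(2) by (intro mult_left_mono) auto
  ultimately show ?thesis by (simp add: u_def)
qed

locale mgf_dominated_process = P: prob_space P + T: sigma_finite_measure \<mu>
  for P :: "'w measure" and \<mu> :: "'t measure" +
  fixes \<phi> :: "real \<Rightarrow> real" and Y :: "'t \<Rightarrow> 'w \<Rightarrow> real"
  assumes N_function: "N_function \<phi>"
    and measurable_process: "measurable_process \<mu> P Y"
    and integrable_exp: "t \<in> space \<mu> \<Longrightarrow> integrable P (\<lambda>\<omega>. exp (l * Y t \<omega>))"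
    and dominated: "t \<in> space \<mu> \<Longrightarrow> mgf_dominators \<phi> P (Y t) \<noteq> {}"
begin

sublocale TP: pair_sigma_finite \<mu> P ..

abbreviation \<tau> :: "'t \<Rightarrow> real" where
  "\<tau> t \<equiv> tau \<phi> P (Y t)"

definition power_integral :: "real \<Rightarrow> 'w \<Rightarrow> ennreal" where
  "power_integral p \<omega> = (\<integral>\<^sup>+ t. ennreal (\<bar>Y t \<omega>\<bar> powr p) \<partial>\<mu>)"

lemma measurable_Y [measurable]: "(\<lambda>(t, \<omega>). Y t \<omega>) \<in> borel_measurable (\<mu> \<Otimes>\<^sub>M P)"
  using measurable_process by (simp add: measurable_process_def)

lemma measurable_Y_fst [measurable]: "\<omega> \<in> space P \<Longrightarrow> (\<lambda>t. Y t \<omega>) \<in> borel_measurable \<mu>"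
  by measurable

lemma tau_nonneg: "t \<in> space \<mu> \<Longrightarrow> 0 \<le> \<tau> t"
  using tau_in_mgf_dominators[OF N_function dominated] by (simp add: mgf_dominators_def)

lemma measurable_tau [measurable]: "\<tau> \<in> borel_measurable \<mu>"
  unfolding borel_measurable_iff_le
proof
  fix a :: real
  show "{t \<in> space \<mu>. \<tau> t \<le> a} \<in> sets \<mu>"
  proof (cases "0 \<le> a")
    case True
    have "{t \<in> space \<mu>. \<tau> t \<le> a} =
      {t \<in> space \<mu>. \<forall>l\<in>\<rat>. integral\<^sup>L P (\<lambda>\<omega>. exp (l * Y t \<omega>)) \<le> exp (\<phi> (l * a))}"
    proof (rule Collect_cong, rule conj_cong[OF refl])
      fix t assume t: "t \<in> space \<mu>"
      show "\<tau> t \<le> a \<longleftrightarrow> (\<forall>l\<in>\<rat>. integral\<^sup>L P (\<lambda>\<omega>. exp (l * Y t \<omega>)) \<le> exp (\<phi> (l * a)))"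
        unfolding tau_le_iff[OF N_function dominated[OF t] True]
          mgf_dominators_rational[OF N_function integrable_exp[OF t]]
        using True by simp
    qed
    also have "\<dots> \<in> sets \<mu>"
    proof (rule sets.sets_Collect_countable_All'[OF _ countable_rat])
      fix l :: real
      have "(\<lambda>t. integral\<^sup>L P (\<lambda>\<omega>. exp (l * Y t \<omega>))) \<in> borel_measurable \<mu>"
        by measurable
      then show "{t \<in> space \<mu>. integral\<^sup>L P (\<lambda>\<omega>. exp (l * Y t \<omega>)) \<le> exp (\<phi> (l * a))} \<in> sets \<mu>"
        by measurable
    qed
    finally show ?thesis .
  next
    case False
    then have "{t \<in> space \<mu>. \<tau> t \<le> a} = {}" using tau_nonneg by fastforce
    then show ?thesis by (metis sets.empty_sets)
  qed
qed

lemma measurable_power_integral [measurable]: "power_integral p \<in> borel_measurable P"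
  unfolding power_integral_def[abs_def] by measurable

text \<open>At points with \<open>\<tau> t = 0\<close> the quotient \<open>\<bar>Y t \<omega>\<bar> / \<tau> t\<close> carries no information about
  \<open>Y t \<omega>\<close>; the estimates through this quotient extend to them because \<open>Y t\<close> vanishes there.\<close>

lemma AE_zero_of_tau_zero: "AE \<omega> in P. AE t in \<mu>. \<tau> t = 0 \<longrightarrow> Y t \<omega> = 0"
proof -
  have "AE t in \<mu>. AE \<omega> in P. \<tau> t = 0 \<longrightarrow> Y t \<omega> = 0"
  proof (rule AE_I2)
    fix t assume t: "t \<in> space \<mu>"
    show "AE \<omega> in P. \<tau> t = 0 \<longrightarrow> Y t \<omega> = 0"
      using P.tau_zero_imp_AE_zero[OF N_function integrable_exp[OF t] dominated[OF t]]
      by (cases "\<tau> t = 0") auto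
  qed
  then show ?thesis
    by (subst (asm) TP.AE_commute) (auto simp: split_beta')
qed

lemma power_integral_AE_zero:
  assumes "(\<integral>\<^sup>+ t. ennreal (\<tau> t powr p) \<partial>\<mu>) = 0"
  shows "AE \<omega> in P. power_integral p \<omega> = 0"
proof -
  have "AE t in \<mu>. ennreal (\<tau> t powr p) = 0"
    using assms by (subst (asm) nn_integral_0_iff_AE) auto
  then have "AE t in \<mu>. \<tau> t = 0" by eventually_elim simp
  then have *: "AE t in \<mu>. Y t \<omega> = 0" if "AE t in \<mu>. \<tau> t = 0 \<longrightarrow> Y t \<omega> = 0" for \<omega>
    using that by eventually_elim simp
  from AE_zero_of_tau_zero have "AE \<omega> in P. AE t in \<mu>. Y t \<omega> = 0"
    by (rule eventually_mono) (rule *)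
  with AE_space show ?thesis
  proof eventually_elim
    case (elim \<omega>)
    from elim(2) have "AE t in \<mu>. ennreal (\<bar>Y t \<omega>\<bar> powr p) = 0"
      by (rule eventually_mono) simp
    then show ?case unfolding power_integral_def using elim(1)
      by (subst nn_integral_0_iff_AE) auto
  qed
qed

text \<open>Let \<open>\<nu>\<close> be the probability measure with density \<open>\<tau> t powr p / c\<close> with respect to \<open>\<mu>\<close>
  and \<open>Z = \<bar>Y\<bar> / \<tau>\<close>. The event says that the \<open>\<nu>\<close>-mean of \<open>(Z / x) powr p\<close> exceeds \<open>1\<close>.
  As \<open>k = \<theta> x / p \<ge> 1\<close>, the preceding chord bound with \<open>w = Z / x\<close> then forces the
  \<open>\<nu>\<close>-mean of \<open>exp (\<theta> Z - \<theta> x)\<close> to be at least \<open>1\<close>, and the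
  Markov inequality together with Tonelli bounds the probability of that by the
  \<open>\<nu>\<close>-mean of \<open>E exp (\<theta> Z - \<theta> x) \<le> 2 exp (\<phi> \<theta> - \<theta> x)\<close>.
  In the proof \<open>\<nu>\<close> is kept as the weight \<open>\<tau> t powr p\<close>, and \<open>J / c\<close> is the \<open>\<nu>\<close>-mean of
  \<open>exp (\<theta> Z - \<theta> x)\<close>.\<close>

lemma power_integral_tail_le:
  assumes p: "1 \<le> p" and x: "0 < x" and \<theta>: "p \<le> \<theta> * x"
    and c: "(\<integral>\<^sup>+ t. ennreal (\<tau> t powr p) \<partial>\<mu>) = ennreal c" "0 < c"
  shows "measure P {\<omega> \<in> space P. power_integral p \<omega> > ennreal (c * x powr p)} \<le> 2 * exp (\<phi> \<theta> - \<theta> * x)"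
proof -
  define k where "k = \<theta> * x / p"
  have k: "1 \<le> k" "k * p = \<theta> * x" using p \<theta> by (auto simp: k_def)
  define h where "h = (\<lambda>t \<omega>. ennreal (\<tau> t powr p * exp (\<theta> * (\<bar>Y t \<omega>\<bar> / \<tau> t) - \<theta> * x)))"
  define J where "J = (\<lambda>\<omega>. \<integral>\<^sup>+ t. h t \<omega> \<partial>\<mu>)"
  have h_meas: "case_prod h \<in> borel_measurable (\<mu> \<Otimes>\<^sub>M P)"
    unfolding h_def split_beta' by measurable
  have h_meas' [measurable]: "\<omega> \<in> space P \<Longrightarrow> (\<lambda>t. h t \<omega>) \<in> borel_measurable \<mu>" for \<omega>
    using h_meas by measurable
  have J_meas [measurable]: "J \<in> borel_measurable P"
    unfolding J_def h_def by measurable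
  have pw: "k / x powr p * \<bar>y\<bar> powr p \<le> s powr p * exp (\<theta> * (\<bar>y\<bar> / s) - \<theta> * x) + (k - 1) * s powr p"
    if s: "0 \<le> s" "s = 0 \<longrightarrow> y = 0" for s y :: real
  proof (cases "s = 0")
    case True
    then show ?thesis using s by simp
  next
    case False
    define w where "w = \<bar>y\<bar> / s / x"
    have w: "0 \<le> w" using s x by (simp add: w_def)
    have y: "\<bar>y\<bar> = s * (x * w)" using x False by (simp add: w_def)
    have "k / x powr p * \<bar>y\<bar> powr p = s powr p * (k * w powr p)"
      using s x w unfolding y by (simp add: powr_mult)
    also have "\<dots> \<le> s powr p * (exp (k * (p * (w - 1))) + (k - 1))"
      by (intro mult_left_mono powr_le_exp_chord w k) (use p in auto)
    also have "k * (p * (w - 1)) = \<theta> * x * (w - 1)"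
      unfolding k(2)[symmetric] by simp
    also have "\<dots> = \<theta> * (\<bar>y\<bar> / s) - \<theta> * x"
      using x by (simp add: w_def algebra_simps)
    finally show ?thesis by (simp add: algebra_simps)
  qed
  have "AE \<omega> in P. ennreal (k / x powr p) * power_integral p \<omega> \<le> J \<omega> + ennreal (k - 1) * ennreal c"
    using AE_space AE_zero_of_tau_zero
  proof eventually_elim
    case (elim \<omega>)
    then have [measurable]: "\<omega> \<in> space P" by simp
    have "ennreal (k / x powr p) * power_integral p \<omega> = (\<integral>\<^sup>+ t. ennreal (k / x powr p) * ennreal (\<bar>Y t \<omega>\<bar> powr p) \<partial>\<mu>)"
      unfolding power_integral_def by (rule nn_integral_cmult[symmetric]) measurable
    also have "\<dots> \<le> (\<integral>\<^sup>+ t. h t \<omega> + ennreal (k - 1) * ennreal (\<tau> t powr p) \<partial>\<mu>)"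
    proof (rule nn_integral_mono_AE)
      show "AE t in \<mu>. ennreal (k / x powr p) * ennreal (\<bar>Y t \<omega>\<bar> powr p)
          \<le> h t \<omega> + ennreal (k - 1) * ennreal (\<tau> t powr p)"
        using AE_space elim(2)
      proof eventually_elim
        case (elim t)
        then have "ennreal (k / x powr p * \<bar>Y t \<omega>\<bar> powr p)
          \<le> ennreal (\<tau> t powr p * exp (\<theta> * (\<bar>Y t \<omega>\<bar> / \<tau> t) - \<theta> * x) + (k - 1) * \<tau> t powr p)"
          using tau_nonneg by (intro ennreal_leI pw) auto
        moreover have "ennreal (k / x powr p) * ennreal (\<bar>Y t \<omega>\<bar> powr p)
            = ennreal (k / x powr p * \<bar>Y t \<omega>\<bar> powr p)"
          using k by (intro ennreal_mult[symmetric]) auto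
        moreover have "h t \<omega> + ennreal (k - 1) * ennreal (\<tau> t powr p) =
            ennreal (\<tau> t powr p * exp (\<theta> * (\<bar>Y t \<omega>\<bar> / \<tau> t) - \<theta> * x) + (k - 1) * \<tau> t powr p)"
          using k by (simp add: h_def flip: ennreal_mult ennreal_plus)
        ultimately show ?case by simp
      qed
    qed
    also have "\<dots> = J \<omega> + ennreal (k - 1) * ennreal c"
      unfolding J_def c(1)[symmetric]
      by (subst nn_integral_add) (auto simp: nn_integral_cmult)
    finally show ?case .
  qed
  then have AE_J: "AE \<omega> in P. power_integral p \<omega> > ennreal (c * x powr p) \<longrightarrow> 1 \<le> ennreal (1 / c) * J \<omega>"
  proof eventually_elim
    case (elim \<omega>)
    show ?case
    proof
      assume gt: "power_integral p \<omega> > ennreal (c * x powr p)"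
      have "ennreal (k * c) = ennreal (k / x powr p) * ennreal (c * x powr p)"
        using x k c by (subst ennreal_mult[symmetric]) auto
      also have "\<dots> \<le> ennreal (k / x powr p) * power_integral p \<omega>"
        using gt by (intro mult_left_mono) auto
      also have "\<dots> \<le> J \<omega> + ennreal (k - 1) * ennreal c" by (rule elim)
      finally have le: "ennreal (k * c) \<le> J \<omega> + ennreal ((k - 1) * c)"
        using k c by (simp add: ennreal_mult)
      show "1 \<le> ennreal (1 / c) * J \<omega>"
      proof (cases "J \<omega>")
        case (real j)
        then have "k * c \<le> j + (k - 1) * c"
          using le k c by (simp add: ennreal_plus[symmetric] del: ennreal_plus)
        then have "1 \<le> 1 / c * j" using c by (simp add: field_simps)
        then have "ennreal 1 \<le> ennreal (1 / c * j)" by (rule ennreal_leI)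
        then have "1 \<le> ennreal (1 / c * j)" by simp
        also have "\<dots> = ennreal (1 / c) * J \<omega>"
          unfolding real(2) using real(1) c by (intro ennreal_mult) auto
        finally show ?thesis .
      next
        case top
        then show ?thesis using c by (simp add: ennreal_mult_top)
      qed
    qed
  qed
  have EJ: "(\<integral>\<^sup>+ \<omega>. J \<omega> \<partial>P) \<le> ennreal (2 * exp (\<phi> \<theta> - \<theta> * x)) * ennreal c"
  proof -
    have "(\<integral>\<^sup>+ \<omega>. J \<omega> \<partial>P) = (\<integral>\<^sup>+ t. (\<integral>\<^sup>+ \<omega>. h t \<omega> \<partial>P) \<partial>\<mu>)"
      unfolding J_def by (rule TP.Fubini'[OF h_meas])
    also have "\<dots> \<le> (\<integral>\<^sup>+ t. ennreal (2 * exp (\<phi> \<theta> - \<theta> * x)) * ennreal (\<tau> t powr p) \<partial>\<mu>)"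
    proof (rule nn_integral_mono)
      fix t assume t: "t \<in> space \<mu>"
      have [measurable]: "Y t \<in> borel_measurable P" using t by measurable
      show "(\<integral>\<^sup>+ \<omega>. h t \<omega> \<partial>P) \<le> ennreal (2 * exp (\<phi> \<theta> - \<theta> * x)) * ennreal (\<tau> t powr p)"
      proof (cases "\<tau> t = 0")
        case True
        then show ?thesis by (simp add: h_def)
      next
        case False
        then have pos: "0 < \<tau> t" using tau_nonneg[OF t] by simp
        have "(\<integral>\<^sup>+ \<omega>. h t \<omega> \<partial>P) = (\<integral>\<^sup>+ \<omega>. ennreal (\<tau> t powr p * exp (- \<theta> * x)) *
            ennreal (exp (\<theta> * (\<bar>Y t \<omega>\<bar> / \<tau> t))) \<partial>P)"
          unfolding h_def by (intro nn_integral_cong) (simp add: exp_diff exp_minus field_simps flip: ennreal_mult)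
        also have "\<dots> = ennreal (\<tau> t powr p * exp (- \<theta> * x)) *
            (\<integral>\<^sup>+ \<omega>. ennreal (exp (\<theta> * (\<bar>Y t \<omega>\<bar> / \<tau> t))) \<partial>P)"
          by (intro nn_integral_cmult) measurable
        also have "\<dots> \<le> ennreal (\<tau> t powr p * exp (- \<theta> * x)) * ennreal (2 * exp (\<phi> \<theta>))"
          by (intro mult_left_mono nn_integral_exp_abs_le[OF N_function integrable_exp[OF t] dominated[OF t] pos]) simp
        also have "\<dots> = ennreal (2 * exp (\<phi> \<theta> - \<theta> * x)) * ennreal (\<tau> t powr p)"
          by (simp add: exp_diff exp_minus field_simps flip: ennreal_mult)
        finally show ?thesis .
      qed
    qed
    also have "\<dots> = ennreal (2 * exp (\<phi> \<theta> - \<theta> * x)) * ennreal c"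
      unfolding c(1)[symmetric] by (rule nn_integral_cmult) measurable
    finally show ?thesis .
  qed
  have "emeasure P {\<omega> \<in> space P. power_integral p \<omega> > ennreal (c * x powr p)}
      \<le> emeasure P {\<omega> \<in> space P. 1 \<le> ennreal (1 / c) * J \<omega>}"
  proof (rule emeasure_mono_AE)
    show "AE \<omega> in P. \<omega> \<in> {\<omega> \<in> space P. power_integral p \<omega> > ennreal (c * x powr p)} \<longrightarrow>
        \<omega> \<in> {\<omega> \<in> space P. 1 \<le> ennreal (1 / c) * J \<omega>}"
      using AE_J by eventually_elim auto
    show "{\<omega> \<in> space P. 1 \<le> ennreal (1 / c) * J \<omega>} \<in> sets P" by measurable
  qed
  also have "\<dots> \<le> ennreal (1 / c) * (\<integral>\<^sup>+ \<omega>. J \<omega> * indicator (space P) \<omega> \<partial>P)"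
    by (rule nn_integral_Markov_inequality) auto
  also have "\<dots> = ennreal (1 / c) * (\<integral>\<^sup>+ \<omega>. J \<omega> \<partial>P)"
    by (simp cong: nn_integral_cong)
  also have "\<dots> \<le> ennreal (1 / c) * (ennreal (2 * exp (\<phi> \<theta> - \<theta> * x)) * ennreal c)"
    by (intro mult_left_mono EJ) simp
  also have "\<dots> = ennreal (2 * exp (\<phi> \<theta> - \<theta> * x))"
    using c by (simp flip: ennreal_mult)
  finally show ?thesis
    by (simp add: P.emeasure_eq_measure)
qed

end

section \<open>Accuracy and reliability of the model\<close>

lemma Lp_norm_gt_iff:
  assumes "0 < p" "0 \<le> \<epsilon>"
  shows "Lp_norm \<mu> p g > ennreal \<epsilon> \<longleftrightarrow> (\<integral>\<^sup>+ t. ennreal (\<bar>g t\<bar> powr p) \<partial>\<mu>) > ennreal (\<epsilon> powr p)"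
proof (cases "\<integral>\<^sup>+ t. ennreal (\<bar>g t\<bar> powr p) \<partial>\<mu>")
  case (real i)
  have "\<epsilon> < i powr (1 / p) \<longleftrightarrow> \<epsilon> powr p < i"
  proof
    assume "\<epsilon> < i powr (1 / p)"
    then have "\<epsilon> powr p < (i powr (1 / p)) powr p" using assms by (intro powr_less_mono2) auto
    then show "\<epsilon> powr p < i" using assms real by (simp add: powr_powr)
  next
    assume "\<epsilon> powr p < i"
    then have "(\<epsilon> powr p) powr (1 / p) < i powr (1 / p)" using assms by (intro powr_less_mono2) auto
    then show "\<epsilon> < i powr (1 / p)" using assms by (simp add: powr_powr)
  qed
  then show ?thesis using real assms by (simp add: Lp_norm_def ennreal_less_iff)
next
  case top
  then show ?thesis by (simp add: Lp_norm_def Let_def)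
qed

theorem theorem10p2:
  fixes \<phi> f :: "real \<Rightarrow> real"
    and \<mu> :: "'t measure" and P :: "'w measure"
    and X XN :: "'t \<Rightarrow> 'w \<Rightarrow> real"
    and p cN \<alpha> \<delta> :: real
  assumes "prob_space P"
    and "sigma_finite_measure \<mu>"
    and "N_function \<phi>" and "condition_Q \<phi>"
    and "measurable_process \<mu> P X" and "Sub_process \<phi> \<mu> P X"
    and "measurable_process \<mu> P XN" and "Sub_process \<phi> \<mu> P XN"
    and "mono_on {0<..} f" and "\<And>u. u > 0 \<Longrightarrow> (f has_integral \<phi> u) {0..u}"
    and "p \<ge> 1"
    and "(\<integral>\<^sup>+ t. ennreal (tau \<phi> P (\<lambda>\<omega>. X t \<omega> - XN t \<omega>) powr p) \<partial>\<mu>) < \<infinity>"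
    and "cN = enn2real (\<integral>\<^sup>+ t. ennreal (tau \<phi> P (\<lambda>\<omega>. X t \<omega> - XN t \<omega>) powr p) \<partial>\<mu>)"
    and "0 < \<alpha>" and "\<alpha> < 1" and "0 < \<delta>"
    and "cN \<le> \<delta> / (young_fenchel_inv \<phi> (ln (2 / \<alpha>))) powr p"
    and "\<delta> > cN * (f (cN powr (1 / p) * p / \<delta> powr (1 / p))) powr p"
  shows "approximates \<mu> P p X XN \<alpha> (\<delta> powr (1 / p)) \<and>
         (p = 1 \<or> \<delta> \<ge> 1 \<longrightarrow> approximates \<mu> P p X XN \<alpha> \<delta>)"
proof -
  interpret P: prob_space P by fact
  interpret T: sigma_finite_measure \<mu> by fact
  define Y where "Y = (\<lambda>t \<omega>. X t \<omega> - XN t \<omega>)"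
  note \<phi> = \<open>N_function \<phi>\<close>
  interpret Y: mgf_dominated_process P \<mu> \<phi> Y
  proof
    show "measurable_process \<mu> P Y"
      using assms(5,7) unfolding measurable_process_def Y_def split_beta' by measurable
    fix t assume "t \<in> space \<mu>"
    then have "X t \<in> Sub \<phi> P" "XN t \<in> Sub \<phi> P"
      using assms(6,8) by (auto simp: Sub_process_def)
    note d = Sub_diff[OF \<phi> this]
    show "integrable P (\<lambda>\<omega>. exp (l * Y t \<omega>))" for l unfolding Y_def by (rule d)
    show "mgf_dominators \<phi> P (Y t) \<noteq> {}" unfolding Y_def by (rule d)
  qed (rule \<phi>)
  have cN: "(\<integral>\<^sup>+ t. ennreal (Y.\<tau> t powr p) \<partial>\<mu>) = ennreal cN" "0 \<le> cN"
    using assms(12,13) by (auto simp: Y_def)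
  define pr where "pr = measure P {\<omega> \<in> space P. Y.power_integral p \<omega> > ennreal \<delta>}"
  have "pr \<le> \<alpha>"
  proof (cases "cN = 0")
    case True
    then have "AE \<omega> in P. Y.power_integral p \<omega> = 0" using cN by (intro Y.power_integral_AE_zero) simp
    then have "AE \<omega> in P. \<not> Y.power_integral p \<omega> > ennreal \<delta>" by eventually_elim simp
    then have "pr = 0" unfolding pr_def by (subst P.prob_eq_0) auto
    then show ?thesis using \<open>0 < \<alpha>\<close> by simp
  next
    case False
    then have c: "0 < cN" using cN by simp
    define L where "L = ln (2 / \<alpha>)"
    define v where "v = young_fenchel_inv \<phi> L"
    have "0 < L" using \<open>0 < \<alpha>\<close> \<open>\<alpha> < 1\<close> by (simp add: L_def)
    note v = young_fenchel_inv_correct[OF \<phi> this, folded v_def]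
    \<comment> \<open>In units of the norms, the threshold \<open>\<delta>\<close> for the integral is \<open>x\<close> for the process.\<close>
    define x where "x = (\<delta> / cN) powr (1 / p)"
    have x: "0 < x" "x powr p = \<delta> / cN"
      using c \<open>0 < \<delta>\<close> \<open>p \<ge> 1\<close> by (auto simp: x_def powr_powr)
    have \<delta>: "cN * x powr p = \<delta>" using x c by simp
    have "v \<le> x"
    proof (rule ccontr)
      assume "\<not> v \<le> x"
      then have "x powr p < v powr p" using x \<open>p \<ge> 1\<close> by (intro powr_less_mono2) auto
      moreover have "cN \<le> \<delta> / v powr p" using assms(17) by (simp add: v_def L_def)
      ultimately show False using x(2) v c by (simp add: field_simps)
    qed
    \<comment> \<open>The tail bound admits exactly the exponents \<open>\<theta> \<ge> b\<close>.\<close>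
    define b where "b = p / x"
    have b: "0 < b" "b = cN powr (1 / p) * p / \<delta> powr (1 / p)"
      using \<open>p \<ge> 1\<close> x(1) c \<open>0 < \<delta>\<close> by (auto simp: b_def x_def powr_divide)
    have "f b \<le> x"
    proof (rule ccontr)
      assume "\<not> f b \<le> x"
      then have "x powr p < f b powr p" using x \<open>p \<ge> 1\<close> by (intro powr_less_mono2) auto
      moreover have "cN * f b powr p < \<delta>" using assms(18) by (simp add: b(2))
      ultimately show False using x(2) c by (simp add: field_simps)
    qed
    show ?thesis
    proof (rule ccontr)
      assume "\<not> pr \<le> \<alpha>"
      then have pr: "\<alpha> < pr" "0 < pr" using \<open>0 < \<alpha>\<close> by auto
      have "young_fenchel \<phi> x \<le> ln (2 / pr)"
      proof (rule young_fenchel_least_right[OF \<phi> assms(9,10) b(1) \<open>f b \<le> x\<close>])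
        fix \<theta> assume "b \<le> \<theta>"
        then have "p \<le> \<theta> * x" using x(1) by (simp add: b_def field_simps)
        then have "pr \<le> 2 * exp (\<phi> \<theta> - \<theta> * x)"
          using Y.power_integral_tail_le[OF \<open>p \<ge> 1\<close> x(1) _ cN(1) c, of \<theta>] unfolding pr_def \<delta> by simp
        then have "exp (x * \<theta> - \<phi> \<theta>) \<le> 2 / pr"
          using pr by (simp add: exp_diff field_simps)
        then show "x * \<theta> - \<phi> \<theta> \<le> ln (2 / pr)"
          using pr by (subst ln_ge_iff) auto
      qed
      also have "\<dots> < L" using pr \<open>0 < \<alpha>\<close> by (simp add: L_def frac_less2)
      also have "L = young_fenchel \<phi> v" using v by simp
      also have "\<dots> \<le> young_fenchel \<phi> x"
        using strict_mono_on_leD[OF strict_mono_on_young_fenchel[OF \<phi>], of v x] v x \<open>v \<le> x\<close> by simp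
      finally show False by simp
    qed
  qed
  have approx: "approximates \<mu> P p X XN \<alpha> \<epsilon>" if \<epsilon>: "0 \<le> \<epsilon>" "\<delta> \<le> \<epsilon> powr p" for \<epsilon>
  proof -
    have "{\<omega> \<in> space P. Lp_norm \<mu> p (\<lambda>t. X t \<omega> - XN t \<omega>) > ennreal \<epsilon>}
        \<subseteq> {\<omega> \<in> space P. Y.power_integral p \<omega> > ennreal \<delta>}"
    proof safe
      fix \<omega> assume "Lp_norm \<mu> p (\<lambda>t. X t \<omega> - XN t \<omega>) > ennreal \<epsilon>"
      then have "ennreal (\<epsilon> powr p) < Y.power_integral p \<omega>"
        using \<epsilon> \<open>p \<ge> 1\<close> unfolding Y.power_integral_def by (subst (asm) Lp_norm_gt_iff) (auto simp: Y_def)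
      then show "ennreal \<delta> < Y.power_integral p \<omega>"
        using ennreal_leI[OF \<epsilon>(2)] by (rule le_less_trans[rotated])
    qed
    then have "measure P {\<omega> \<in> space P. Lp_norm \<mu> p (\<lambda>t. X t \<omega> - XN t \<omega>) > ennreal \<epsilon>} \<le> pr"
      unfolding pr_def by (intro P.finite_measure_mono) auto
    with \<open>pr \<le> \<alpha>\<close> show ?thesis by (simp add: approximates_def)
  qed
  have "approximates \<mu> P p X XN \<alpha> (\<delta> powr (1 / p))"
    using \<open>0 < \<delta>\<close> \<open>p \<ge> 1\<close> by (intro approx) (auto simp: powr_powr)
  moreover have "approximates \<mu> P p X XN \<alpha> \<delta>" if "p = 1 \<or> \<delta> \<ge> 1"
    using that \<open>0 < \<delta>\<close> \<open>p \<ge> 1\<close> powr_mono[of 1 p \<delta>] by (intro approx) auto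
  ultimately show ?thesis by blast
qed

end
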